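(* Let $(X_i)_{i\ge1}$ be i.i.d. with distribution $P_0$ on $\mathbb{X}$, and let $\{P_\theta:\theta\in\Theta\}$ be a well-specified statistical model, i.e. $P_0\in\{P_\theta:\theta\in\Theta\}$. Let $\theta^*\in\arg\min_{\theta\in\Theta}\mathbb{D}_k(P_\theta,P_0)$ (so that $P_{\theta^*}=P_0$) and $\mathcal{B}_n=\{\theta\in\Theta : \mathbb{D}_k(P_\theta,P_{\theta^*})\le n^{-1/2}\}$. Let $\pi$ be a prior probability distribution on $\Theta$ and let $\beta=\beta_n>0$ be such that, for every $n\ge 1$, the prior mass condition $$\pi(\mathcal{B}_n)\ge e^{-\beta/n}$$ holds. Then, for any sequence $M_n\to+\infty$ of positive numbers, $$\pi_n^\beta\left(\left\{\theta\in\Theta:\mathbb{D}_k(P_\theta,P_0)>M_n\cdot n^{-1/2}\right\}\right)\xrightarrow[n\to+\infty]{}0\quad\text{in probability.}$$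
   Context: $(\mathbb{X},\mathcal{X})$ is a measurable space, and $k:\mathbb{X}\times\mathbb{X}\to\mathbb{R}$ is a (measurable, symmetric) positive definite kernel with $|k|\le 1$, which is integrally strictly positive definite (i.e. $\iint k\,d\mu\,d\mu>0$ for every nonzero finite signed measure $\mu$ on $\mathbb{X}$). $\mathcal{H}_k$ is the associated reproducing kernel Hilbert space, with $f(x)=\langle f,k(x,\cdot)\rangle_{\mathcal{H}_k}$ for $f\in\mathcal{H}_k$, $x\in\mathbb{X}$. For a probability distribution $P$ on $\mathbb{X}$ the kernel mean embedding is $\mu_P=\mathbb{E}_{X\sim P}[k(X,\cdot)]\in\mathcal{H}_k$, and the Maximum Mean Discrepancy is $\mathbb{D}_k(P,Q)=\|\mu_P-\mu_Q\|_{\mathcal{H}_k}$; under these assumptions on $k$ it is a metric on probability distributions. $P_0$ is a probability distribution on $\mathbb{X}$ (the data-generating distribution). The parameter space $\Theta$ is equipped with a sigma-algebra, and $\{P_\theta:\theta\in\Theta\}$ is a family of probability distributions on $\mathbb{X}$, with $\theta\mapsto P_\theta$ measurable so that all integrals below make sense. The empirical measure is $\hat P_n=\frac1n\sum_{i=1}^n\delta_{X_i}$. The MMD-Bayes pseudo-posterior with prior $\pi$ and temperature parameter $\beta>0$ is the (random) probability distribution on $\Theta$ defined by $$\pi_n^\beta(d\theta)\propto\exp\left(-\beta\,\mathbb{D}_k^2(P_\theta,\hat P_n)\right)\pi(d\theta).$$ The temperature $\beta$ may depend on $n$. *)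

theory Defs
  imports "HOL-Probability.Probability"
begin

section \<open>Reproducing kernel Hilbert spaces\<close>

definition positive_definite_kernel :: "'x set \<Rightarrow> ('x \<Rightarrow> 'x \<Rightarrow> real) \<Rightarrow> bool" where
  "positive_definite_kernel X k \<longleftrightarrow>
     (\<forall>x\<in>X. \<forall>y\<in>X. k x y = k y x) \<and>
     (\<forall>A c. finite A \<longrightarrow> A \<subseteq> X \<longrightarrow> (\<Sum>x\<in>A. \<Sum>y\<in>A. c x * c y * k x y) \<ge> 0)"

text \<open>
  Real functions on a set \<open>X\<close> are represented by total functions that vanish outside \<open>X\<close>, so that
  equality of representatives is equality on \<open>X\<close> and pointwise linear combinations stay
  representatives.
\<close>

definition kernel_section :: "'x set \<Rightarrow> ('x \<Rightarrow> 'x \<Rightarrow> real) \<Rightarrow> 'x \<Rightarrow> ('x \<Rightarrow> real)" where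
  "kernel_section X k x = (\<lambda>y. if y \<in> X then k x y else 0)"

definition ip_norm :: "(('x \<Rightarrow> real) \<Rightarrow> ('x \<Rightarrow> real) \<Rightarrow> real) \<Rightarrow> ('x \<Rightarrow> real) \<Rightarrow> real" where
  "ip_norm ip f = sqrt (ip f f)"

text \<open>
  \<open>rkhs X k H ip\<close>: the set \<open>H\<close> of real functions on \<open>X\<close> with inner product \<open>ip\<close> is the reproducing
  kernel Hilbert space of \<open>k\<close>. By the Moore-Aronszajn theorem, \<open>H\<close> (and \<open>ip\<close> on \<open>H\<close>) exists and is
  unique for every positive definite kernel \<open>k\<close> on \<open>X\<close>. No separability is assumed.
\<close>

locale rkhs =
  fixes X :: "'x set"
    and k :: "'x \<Rightarrow> 'x \<Rightarrow> real"
    and H :: "('x \<Rightarrow> real) set"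
    and ip :: "('x \<Rightarrow> real) \<Rightarrow> ('x \<Rightarrow> real) \<Rightarrow> real"
  assumes vanish_outside: "\<And>f x. f \<in> H \<Longrightarrow> x \<notin> X \<Longrightarrow> f x = 0"
    and zero_closed: "(\<lambda>x. 0) \<in> H"
    and add_closed: "\<And>f g. f \<in> H \<Longrightarrow> g \<in> H \<Longrightarrow> (\<lambda>x. f x + g x) \<in> H"
    and scale_closed: "\<And>c f. f \<in> H \<Longrightarrow> (\<lambda>x. c * f x) \<in> H"
    and ip_commute: "\<And>f g. f \<in> H \<Longrightarrow> g \<in> H \<Longrightarrow> ip f g = ip g f"
    and ip_add_left: "\<And>f g h. f \<in> H \<Longrightarrow> g \<in> H \<Longrightarrow> h \<in> H \<Longrightarrow>
          ip (\<lambda>x. f x + g x) h = ip f h + ip g h"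
    and ip_scale_left: "\<And>c f g. f \<in> H \<Longrightarrow> g \<in> H \<Longrightarrow> ip (\<lambda>x. c * f x) g = c * ip f g"
    and ip_nonneg: "\<And>f. f \<in> H \<Longrightarrow> ip f f \<ge> 0"
    and ip_definite: "\<And>f. f \<in> H \<Longrightarrow> ip f f = 0 \<Longrightarrow> f = (\<lambda>x. 0)"
    and complete: "\<And>F :: nat \<Rightarrow> 'x \<Rightarrow> real. (\<And>n. F n \<in> H) \<Longrightarrow>
          (\<And>e. e > 0 \<Longrightarrow> \<exists>N. \<forall>m\<ge>N. \<forall>n\<ge>N. ip_norm ip (\<lambda>x. F m x - F n x) < e) \<Longrightarrow>
          \<exists>f\<in>H. (\<lambda>n. ip_norm ip (\<lambda>x. F n x - f x)) \<longlonglongrightarrow> 0"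
    and section_closed: "\<And>x. x \<in> X \<Longrightarrow> kernel_section X k x \<in> H"
    and reproducing: "\<And>f x. f \<in> H \<Longrightarrow> x \<in> X \<Longrightarrow> ip f (kernel_section X k x) = f x"

section \<open>Kernel mean embedding and maximum mean discrepancy\<close>

text \<open>
  The \<open>H\<close>-valued expectation of \<open>k(x, \<cdot>)\<close> under \<open>P\<close> is taken in the weak sense: it is the element
  \<open>h\<close> of \<open>H\<close> with \<open>\<langle>f, h\<rangle> = E \<langle>f, k(x, \<cdot>)\<rangle> = E f(x)\<close> for all \<open>f \<in> H\<close>. It exists for every finite
  measure when \<open>k\<close> is bounded and measurable, and it agrees with the Bochner integral whenever the
  latter exists (which would additionally need \<open>x \<mapsto> k(x, \<cdot>)\<close> to be almost separably valued).
\<close>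

definition mean_embedding ::
  "('x \<Rightarrow> real) set \<Rightarrow> (('x \<Rightarrow> real) \<Rightarrow> ('x \<Rightarrow> real) \<Rightarrow> real) \<Rightarrow> 'x measure \<Rightarrow> ('x \<Rightarrow> real)" where
  "mean_embedding H ip P = (THE h. h \<in> H \<and> (\<forall>f\<in>H. ip f h = (\<integral>x. f x \<partial>P)))"

definition mmd ::
  "('x \<Rightarrow> real) set \<Rightarrow> (('x \<Rightarrow> real) \<Rightarrow> ('x \<Rightarrow> real) \<Rightarrow> real) \<Rightarrow>
   'x measure \<Rightarrow> 'x measure \<Rightarrow> real" where
  "mmd H ip P Q = ip_norm ip (\<lambda>x. mean_embedding H ip P x - mean_embedding H ip Q x)"

section \<open>Integrally strictly positive definite kernels\<close>

definition finite_signed_measure :: "'x measure \<Rightarrow> ('x set \<Rightarrow> real) \<Rightarrow> bool" where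
  "finite_signed_measure S \<nu> \<longleftrightarrow>
     \<nu> {} = 0 \<and>
     (\<forall>A :: nat \<Rightarrow> 'x set. range A \<subseteq> sets S \<longrightarrow> disjoint_family A \<longrightarrow>
        (\<lambda>i. \<nu> (A i)) sums \<nu> (\<Union>i. A i))"

text \<open>
  Jordan decomposition: the positive part of \<open>\<nu>\<close> is the upper variation
  \<open>A \<mapsto> sup {\<nu> B | B \<subseteq> A measurable}\<close>, and the negative part is the positive part of \<open>-\<nu>\<close>. (As
  \<open>\<nu> {} = 0\<close>, the truncation of negative values by \<open>ennreal\<close> does not affect the supremum.)
\<close>

definition positive_variation :: "'x measure \<Rightarrow> ('x set \<Rightarrow> real) \<Rightarrow> 'x measure" where
  "positive_variation S \<nu> =
     measure_of (space S) (sets S) (\<lambda>A. SUP B\<in>{B \<in> sets S. B \<subseteq> A}. ennreal (\<nu> B))"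

definition signed_integral :: "'x measure \<Rightarrow> ('x set \<Rightarrow> real) \<Rightarrow> ('x \<Rightarrow> real) \<Rightarrow> real" where
  "signed_integral S \<nu> f =
     (\<integral>x. f x \<partial>positive_variation S \<nu>) - (\<integral>x. f x \<partial>positive_variation S (\<lambda>A. - \<nu> A))"

definition integrally_strictly_pd :: "'x measure \<Rightarrow> ('x \<Rightarrow> 'x \<Rightarrow> real) \<Rightarrow> bool" where
  "integrally_strictly_pd S k \<longleftrightarrow>
     (\<forall>\<nu>. finite_signed_measure S \<nu> \<longrightarrow> (\<exists>A\<in>sets S. \<nu> A \<noteq> 0) \<longrightarrow>
        signed_integral S \<nu> (\<lambda>x. signed_integral S \<nu> (\<lambda>y. k x y)) > 0)"

section \<open>Empirical measure, pseudo-posterior, convergence in probability\<close>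

definition empirical_measure :: "'x measure \<Rightarrow> nat \<Rightarrow> (nat \<Rightarrow> 'x) \<Rightarrow> 'x measure" where
  "empirical_measure S n x =
     measure_of (space S) (sets S) (\<lambda>A. (\<Sum>i=1..n. emeasure (return S (x i)) A) / of_nat n)"

definition mmd_posterior ::
  "('x \<Rightarrow> real) set \<Rightarrow> (('x \<Rightarrow> real) \<Rightarrow> ('x \<Rightarrow> real) \<Rightarrow> real) \<Rightarrow>
   ('t \<Rightarrow> 'x measure) \<Rightarrow> 't measure \<Rightarrow> real \<Rightarrow> 'x measure \<Rightarrow> 't measure" where
  "mmd_posterior H ip P \<pi> \<beta> Q =
     density \<pi> (\<lambda>\<theta>. ennreal (exp (- \<beta> * (mmd H ip (P \<theta>) Q)\<^sup>2) /
                             (\<integral>t. exp (- \<beta> * (mmd H ip (P t) Q)\<^sup>2) \<partial>\<pi>)))"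

text \<open>Measurability of the \<open>Y n\<close> is part of the notion, so that the probabilities are meaningful.\<close>

definition converges_in_probability ::
  "'w measure \<Rightarrow> (nat \<Rightarrow> 'w \<Rightarrow> real) \<Rightarrow> real \<Rightarrow> bool" where
  "converges_in_probability \<Omega> Y c \<longleftrightarrow>
     (\<forall>n. Y n \<in> borel_measurable \<Omega>) \<and>
     (\<forall>\<epsilon>>0. (\<lambda>n. measure \<Omega> {\<omega> \<in> space \<Omega>. \<bar>Y n \<omega> - c\<bar> > \<epsilon>}) \<longlonglongrightarrow> 0)"

end

theory Submission
  imports Defs
begin

text \<open>
  Write \<open>r = n\<^sup>-\<^sup>1\<^sup>/\<^sup>2\<close> and let \<open>d\<close> be the discrepancy between \<open>P0\<close> and the empirical measure. The proof
  plays off three facts.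

  The empirical measure is close to \<open>P0\<close>: \<open>d\<^sup>2\<close> is the average over all \<open>n\<^sup>2\<close> index pairs of a centred
  kernel evaluated at the sample. By independence the off-diagonal terms have mean zero, and a diagonal
  term has mean at most one, so the mean of \<open>d\<^sup>2\<close> is at most \<open>r\<^sup>2\<close> (\<open>expectation_mmd_empirical\<close>). By
  Markov's inequality, \<open>d \<le> M r / 4\<close> outside an event of probability at most \<open>16 / M\<^sup>2\<close>.

  On that event the posterior is controlled deterministically. By the triangle inequality, the loss
  (the squared discrepancy between a model distribution and the empirical measure) is at least
  \<open>(3 M r / 4)\<^sup>2\<close> on the set of bad parameters and at most \<open>(r + M r / 4)\<^sup>2\<close> on the prior neighbourhood
  whose mass is at least \<open>exp (- t)\<close>, where \<open>t = \<beta> r\<^sup>2\<close>. For \<open>M \<ge> 4\<close> the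
  exponential weights therefore penalise the bad parameters, relative to the neighbourhood and after paying
  for its prior mass, by a factor of at most \<open>exp (- t M\<^sup>2 / 4)\<close>.

  The temperature may grow more slowly than \<open>n\<close>, so that \<open>t\<close> tends to \<open>0\<close> and the exponential alone may not
  be small. But then the prior mass condition says that almost all prior mass lies in the
  neighbourhood: the bad parameters have prior mass at most \<open>1 - exp (- t) \<le> t\<close>
  (\<open>Gibbs_mass_bound\<close>). The posterior mass is thus at most \<open>t exp (- t M\<^sup>2 / 4) \<le> 4 / M\<^sup>2\<close>, uniformly in
  \<open>t\<close> (\<open>posterior_mass_bound\<close>), and this tends to \<open>0\<close>.

  All of this rests on mean embeddings being genuine elements of the Hilbert space. Without
  separability a Bochner integral of the kernel sections is not available; both the measurability of the
  elements of the space and the existence of weak mean embeddings come from a Riesz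
  representation argument on a subspace (\<open>Riesz_on_subspace\<close>), proved by minimising a quadratic
  functional. In the well-specified case the minimiser \<open>\<theta>s\<close> has discrepancy zero to \<open>P0\<close>, so it can be exchanged for the true parameter.
\<close>

section \<open>Geometry of a reproducing kernel Hilbert space\<close>

context rkhs
begin

abbreviation hnorm :: "('x \<Rightarrow> real) \<Rightarrow> real" where
  "hnorm f \<equiv> ip_norm ip f"

lemma diff_closed:
  assumes "f \<in> H" "g \<in> H"
  shows "(\<lambda>x. f x - g x) \<in> H"
  using add_closed[OF assms(1) scale_closed[OF assms(2), of "-1"]] by simp

lemma ip_diff_left:
  assumes "f \<in> H" "g \<in> H" "h \<in> H"
  shows "ip (\<lambda>x. f x - g x) h = ip f h - ip g h"
  using ip_add_left[OF assms(1) scale_closed[OF assms(2), of "-1"] assms(3)]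
    ip_scale_left[OF assms(2,3), of "-1"] by simp

lemma ip_add_right:
  assumes "f \<in> H" "g \<in> H" "h \<in> H"
  shows "ip h (\<lambda>x. f x + g x) = ip h f + ip h g"
  using assms by (simp add: ip_commute[of h] add_closed ip_add_left)

lemma ip_diff_right:
  assumes "f \<in> H" "g \<in> H" "h \<in> H"
  shows "ip h (\<lambda>x. f x - g x) = ip h f - ip h g"
  using assms by (simp add: ip_commute[of h] diff_closed ip_diff_left)

lemma ip_scale_right:
  assumes "f \<in> H" "g \<in> H"
  shows "ip g (\<lambda>x. c * f x) = c * ip g f"
  using assms by (simp add: ip_commute[of g] scale_closed ip_scale_left)

lemma hnorm_nonneg: "f \<in> H \<Longrightarrow> 0 \<le> hnorm f"
  by (simp add: ip_norm_def ip_nonneg)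

lemma hnorm_square: "f \<in> H \<Longrightarrow> (hnorm f)\<^sup>2 = ip f f"
  by (simp add: ip_norm_def ip_nonneg)

lemma ip_add_scaled:
  assumes "f \<in> H" "g \<in> H"
  shows "ip (\<lambda>x. f x + c * g x) (\<lambda>x. f x + c * g x) = ip f f + 2 * c * ip f g + c\<^sup>2 * ip g g"
proof -
  have cg: "(\<lambda>x. c * g x) \<in> H" by (rule scale_closed[OF assms(2)])
  show ?thesis
    by (simp add: ip_add_left[OF assms(1) cg add_closed[OF assms(1) cg]]
        ip_add_right[OF assms(1) cg assms(1)] ip_add_right[OF assms(1) cg cg]
        ip_scale_left[OF assms(2) assms(1)] ip_scale_left[OF assms(2) cg]
        ip_scale_right[OF assms(2,1)] ip_scale_right[OF assms(2,2)]
        ip_commute[OF assms(2,1)] power2_eq_square algebra_simps)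
qed

lemma ip_diff_diff:
  assumes "f \<in> H" "g \<in> H"
  shows "ip (\<lambda>x. f x - g x) (\<lambda>x. f x - g x) = ip f f - 2 * ip f g + ip g g"
  using ip_add_scaled[OF assms, of "-1"] by simp

lemma Cauchy_Schwarz:
  assumes f: "f \<in> H" and g: "g \<in> H"
  shows "\<bar>ip f g\<bar> \<le> hnorm f * hnorm g"
proof (cases "ip g g = 0")
  case True
  then have "g = (\<lambda>x. 0)" using ip_definite g by blast
  then have "ip f g = 0" using ip_scale_right[OF f f, of 0] by simp
  then show ?thesis using hnorm_nonneg f g by simp
next
  case False
  then have pos: "ip g g > 0" using ip_nonneg[OF g] by simp
  have "0 \<le> ip f f + 2 * (- ip f g / ip g g) * ip f g + (- ip f g / ip g g)\<^sup>2 * ip g g"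
    unfolding ip_add_scaled[OF f g, symmetric]
    by (rule ip_nonneg[OF add_closed[OF f scale_closed[OF g]]])
  also have "\<dots> = ip f f - (ip f g)\<^sup>2 / ip g g"
    using pos by (simp add: field_simps power2_eq_square)
  finally have "(ip f g)\<^sup>2 \<le> ip f f * ip g g"
    using pos by (simp add: field_simps)
  then have "(ip f g)\<^sup>2 \<le> (hnorm f * hnorm g)\<^sup>2"
    using f g by (simp add: power_mult_distrib hnorm_square)
  then have "\<bar>ip f g\<bar> \<le> \<bar>hnorm f * hnorm g\<bar>" by (simp only: abs_le_square_iff)
  then show ?thesis using hnorm_nonneg[OF f] hnorm_nonneg[OF g] by simp
qed

lemma hnorm_triangle:
  assumes f: "f \<in> H" and g: "g \<in> H"
  shows "hnorm (\<lambda>x. f x + g x) \<le> hnorm f + hnorm g"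
proof (rule power2_le_imp_le)
  have "(hnorm (\<lambda>x. f x + g x))\<^sup>2 = (hnorm f)\<^sup>2 + 2 * ip f g + (hnorm g)\<^sup>2"
    using ip_add_scaled[OF f g, of 1] by (simp add: hnorm_square add_closed f g)
  also have "\<dots> \<le> (hnorm f + hnorm g)\<^sup>2"
    using Cauchy_Schwarz[OF f g] by (simp add: power2_sum)
  finally show "(hnorm (\<lambda>x. f x + g x))\<^sup>2 \<le> (hnorm f + hnorm g)\<^sup>2" .
qed (use hnorm_nonneg f g in simp)

lemma hnorm_minus_commute:
  assumes "f \<in> H" "g \<in> H"
  shows "hnorm (\<lambda>x. f x - g x) = hnorm (\<lambda>x. g x - f x)"
  using assms by (simp add: ip_norm_def ip_diff_diff ip_commute)

lemma ip_tendsto: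
  assumes "\<And>n. G n \<in> H" "h \<in> H" "f \<in> H" "(\<lambda>n. hnorm (\<lambda>x. G n x - h x)) \<longlonglongrightarrow> 0"
  shows "(\<lambda>n. ip (G n) f) \<longlonglongrightarrow> ip h f"
proof -
  have "(\<lambda>n. ip (G n) f - ip h f) \<longlonglongrightarrow> 0"
  proof (rule Lim_null_comparison)
    show "\<forall>\<^sub>F n in sequentially. norm (ip (G n) f - ip h f) \<le> hnorm (\<lambda>x. G n x - h x) * hnorm f"
      using Cauchy_Schwarz[OF diff_closed[OF assms(1,2)] assms(3)]
      by (simp add: ip_diff_left assms)
    show "(\<lambda>n. hnorm (\<lambda>x. G n x - h x) * hnorm f) \<longlonglongrightarrow> 0"
      using tendsto_mult_right[OF assms(4), of "hnorm f"] by simp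
  qed
  then show ?thesis by (simp add: LIM_zero_iff)
qed

text \<open>
  The functional \<open>J g = \<parallel>g\<parallel>\<^sup>2 - 2 L g\<close> is bounded below, and by the parallelogram law every minimising
  sequence is Cauchy. Its limit represents \<open>L\<close> because the first variation of \<open>J\<close> vanishes there. If
  \<open>V\<close> is not closed, the representing element lies in its closure; the approximating sequence is
  returned so that a property shared by the elements of \<open>V\<close> can be carried over to the limit.
\<close>

lemma Riesz_on_subspace:
  fixes L :: "('x \<Rightarrow> real) \<Rightarrow> real"
  assumes V: "V \<subseteq> H" "(\<lambda>x. 0) \<in> V"
    and V_add: "\<And>f g. f \<in> V \<Longrightarrow> g \<in> V \<Longrightarrow> (\<lambda>x. f x + g x) \<in> V"
    and V_scale: "\<And>c f. f \<in> V \<Longrightarrow> (\<lambda>x. c * f x) \<in> V"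
    and L_add: "\<And>f g. f \<in> V \<Longrightarrow> g \<in> V \<Longrightarrow> L (\<lambda>x. f x + g x) = L f + L g"
    and L_scale: "\<And>c f. f \<in> V \<Longrightarrow> L (\<lambda>x. c * f x) = c * L f"
    and L_bounded: "\<And>f. f \<in> V \<Longrightarrow> \<bar>L f\<bar> \<le> B * hnorm f"
  obtains G h where "\<And>n. G n \<in> V" "h \<in> H" "(\<lambda>n. hnorm (\<lambda>x. G n x - h x)) \<longlonglongrightarrow> 0"
    "\<And>f. f \<in> V \<Longrightarrow> ip f h = L f"
proof -
  define J where "J g = ip g g - 2 * L g" for g
  have VH: "f \<in> H" if "f \<in> V" for f using that V by auto
  have lower: "- B\<^sup>2 \<le> J g" if "g \<in> V" for g
  proof -
    have "L g \<le> B * hnorm g" using L_bounded[OF that] by linarith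
    then have "J g + B\<^sup>2 \<ge> (hnorm g - B)\<^sup>2"
      by (simp add: J_def power2_diff hnorm_square[OF VH[OF that], symmetric] algebra_simps)
    then show ?thesis using zero_le_power2[of "hnorm g - B"] by linarith
  qed
  define m where "m = Inf (J ` V)"
  have bdd: "bdd_below (J ` V)" using lower by (intro bdd_belowI2)
  have m_le: "m \<le> J g" if "g \<in> V" for g
    unfolding m_def using bdd that by (intro cInf_lower) auto
  have "\<exists>g\<in>V. J g < m + 1 / real (Suc n)" for n
    using cInf_lessD[of "J ` V" "m + 1 / real (Suc n)"] V(2) unfolding m_def by force
  then have "\<exists>G. \<forall>n. G n \<in> V \<and> J (G n) < m + 1 / real (Suc n)" by (intro choice) blast
  then obtain G where GV: "\<And>n. G n \<in> V" and GJ: "\<And>n. J (G n) < m + 1 / real (Suc n)"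
    by blast
  have J_add: "J (\<lambda>x. u x + c * v x) = J u + 2 * c * (ip u v - L v) + c\<^sup>2 * ip v v"
    if "u \<in> V" "v \<in> V" for u v c
    using that by (simp add: J_def ip_add_scaled VH L_add V_scale L_scale algebra_simps)
  \<comment> \<open>Compare the values of \<open>J\<close> at \<open>u\<close>, \<open>v\<close> and their midpoint.\<close>
  have parallelogram: "(hnorm (\<lambda>x. u x - v x))\<^sup>2 \<le> 2 * (J u - m) + 2 * (J v - m)"
    if u: "u \<in> V" and v: "v \<in> V" for u v
  proof -
    define w where "w = (\<lambda>x. v x + (-1) * u x)"
    have w: "w \<in> V" unfolding w_def using u v V_add V_scale by blast
    have v_eq: "v = (\<lambda>x. u x + 1 * w x)" by (simp add: w_def)
    have "m \<le> J (\<lambda>x. u x + (1/2) * w x)" by (intro m_le V_add V_scale u w)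
    moreover have "J v = J u + 2 * 1 * (ip u w - L w) + 1\<^sup>2 * ip w w"
      by (subst v_eq) (rule J_add[OF u w])
    moreover have "(hnorm (\<lambda>x. u x - v x))\<^sup>2 = ip w w"
      using hnorm_minus_commute[OF VH[OF u] VH[OF v]] hnorm_square[OF VH[OF w]]
      by (simp add: w_def)
    ultimately show ?thesis
      unfolding J_add[OF u w] by (simp add: power2_eq_square algebra_simps)
  qed
  have "\<exists>h\<in>H. (\<lambda>n. hnorm (\<lambda>x. G n x - h x)) \<longlonglongrightarrow> 0"
  proof (rule complete)
    show "G n \<in> H" for n by (rule VH[OF GV])
    fix e :: real assume e: "e > 0"
    obtain N where N: "4 / e\<^sup>2 < real N" using reals_Archimedean2 by blast
    have "4 < real N * e\<^sup>2" using N e by (simp only: pos_divide_less_eq zero_less_power)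
    also have "\<dots> \<le> real (Suc N) * e\<^sup>2" by (intro mult_right_mono) auto
    finally have N': "4 / real (Suc N) < e\<^sup>2"
      by (simp only: pos_divide_less_eq of_nat_0_less_iff zero_less_Suc mult.commute)
    have "hnorm (\<lambda>x. G i x - G j x) < e" if "i \<ge> N" "j \<ge> N" for i j
    proof (rule power2_less_imp_less)
      have "1 / real (Suc i) \<le> 1 / real (Suc N)" "1 / real (Suc j) \<le> 1 / real (Suc N)"
        using that by (auto simp: field_simps)
      then show "(hnorm (\<lambda>x. G i x - G j x))\<^sup>2 < e\<^sup>2"
        using parallelogram[OF GV GV, of i j] GJ[of i] GJ[of j] N' by simp
    qed (use e in simp)
    then show "\<exists>N. \<forall>i\<ge>N. \<forall>j\<ge>N. hnorm (\<lambda>x. G i x - G j x) < e" by blast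
  qed
  then obtain h where h: "h \<in> H" "(\<lambda>n. hnorm (\<lambda>x. G n x - h x)) \<longlonglongrightarrow> 0" by blast
  have "ip f h = L f" if f: "f \<in> V" for f
  proof -
    have ineq: "0 \<le> 2 * c * (ip h f - L f) + c\<^sup>2 * ip f f" for c
    proof (rule LIMSEQ_le_const)
      have "(\<lambda>n. 2 * c * (ip (G n) f - L f) + c\<^sup>2 * ip f f + inverse (real (Suc n)))
          \<longlonglongrightarrow> 2 * c * (ip h f - L f) + c\<^sup>2 * ip f f + 0"
        using ip_tendsto[OF VH[OF GV] h(1) VH[OF f] h(2)]
        by (intro tendsto_intros LIMSEQ_inverse_real_of_nat)
      then show "(\<lambda>n. 2 * c * (ip (G n) f - L f) + c\<^sup>2 * ip f f + inverse (real (Suc n)))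
          \<longlonglongrightarrow> 2 * c * (ip h f - L f) + c\<^sup>2 * ip f f" by simp
      have "0 \<le> 2 * c * (ip (G n) f - L f) + c\<^sup>2 * ip f f + inverse (real (Suc n))" for n
        using m_le[OF V_add[OF GV V_scale[OF f]], of n c] GJ[of n]
        unfolding J_add[OF GV f] by (simp add: inverse_eq_divide)
      then show "\<exists>N. \<forall>n\<ge>N. 0 \<le> 2 * c * (ip (G n) f - L f) + c\<^sup>2 * ip f f + inverse (real (Suc n))"
        by blast
    qed
    \<comment> \<open>The quadratic in \<open>c\<close> is nonnegative with no constant term, so its linear coefficient is zero:
      evaluate near its minimum, with \<open>q\<close> in place of \<open>\<parallel>f\<parallel>\<^sup>2\<close> to have a positive denominator.\<close>
    define d where "d = ip h f - L f"
    define q where "q = 1 + ip f f"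
    have q: "q > 0" "ip f f \<le> q" using ip_nonneg[OF VH[OF f]] by (auto simp: q_def)
    have "0 \<le> 2 * (- d / q) * d + (- d / q)\<^sup>2 * ip f f" using ineq[of "- d / q"] by (simp add: d_def)
    also have "\<dots> \<le> 2 * (- d / q) * d + (- d / q)\<^sup>2 * q"
      using q by (intro add_left_mono mult_left_mono) auto
    also have "\<dots> = - d\<^sup>2 / q" using q by (simp add: field_simps power2_eq_square)
    finally have "d\<^sup>2 \<le> 0" using q by (simp add: field_simps)
    then have "d = 0" by simp
    then show ?thesis using ip_commute[OF h(1) VH[OF f]] by (simp add: d_def)
  qed
  then show ?thesis using that[of G h, OF GV h] by blast
qed

end

section \<open>Mean embeddings for a bounded measurable kernel\<close>

text \<open>
  Pushing \<open>L x\<close> forward along \<open>f x\<close> turns the integrand into the identity, and then integration is a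
  measurable map on the space of measures.
\<close>

lemma integral_measurable_kernel:
  fixes f :: "'a \<Rightarrow> 'b \<Rightarrow> real"
  assumes f: "(\<lambda>(x, y). f x y) \<in> borel_measurable (M \<Otimes>\<^sub>M N)"
    and L: "L \<in> M \<rightarrow>\<^sub>M prob_algebra N"
  shows "(\<lambda>x. \<integral>y. f x y \<partial>L x) \<in> borel_measurable M"
proof -
  have "(\<lambda>x. distr (L x) borel (f x)) \<in> M \<rightarrow>\<^sub>M subprob_algebra borel"
    by (rule measurable_distr2[OF f measurable_prob_algebraD[OF L]])
  from measurable_compose[OF this integral_measurable_subprob_algebra[OF measurable_ident_sets[OF refl]]]
  have "(\<lambda>x. \<integral>z. id z \<partial>distr (L x) borel (f x)) \<in> borel_measurable M"
    by (simp add: id_def)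
  moreover have "(\<integral>z. id z \<partial>distr (L x) borel (f x)) = (\<integral>y. f x y \<partial>L x)" if x: "x \<in> space M" for x
  proof -
    have "sets (L x) = sets N" using measurable_space[OF L x] by (simp add: space_prob_algebra)
    moreover have "f x \<in> borel_measurable N"
      using measurable_Pair2[OF f x] by simp
    ultimately have "f x \<in> borel_measurable (L x)" by (simp cong: measurable_cong_sets)
    then show ?thesis by (subst integral_distr) auto
  qed
  ultimately show ?thesis by (simp cong: measurable_cong)
qed

locale bounded_measurable_rkhs = rkhs "space S" k H ip
  for S :: "'x measure" and k H ip +
  assumes kernel_measurable: "(\<lambda>(x, y). k x y) \<in> borel_measurable (S \<Otimes>\<^sub>M S)"
    and kernel_bounded: "\<And>x y. x \<in> space S \<Longrightarrow> y \<in> space S \<Longrightarrow> \<bar>k x y\<bar> \<le> 1"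
begin

lemma hnorm_section_le_1:
  assumes "x \<in> space S"
  shows "hnorm (kernel_section (space S) k x) \<le> 1"
  using reproducing[OF section_closed[OF assms] assms] kernel_bounded[OF assms assms] assms
  by (simp add: ip_norm_def kernel_section_def)

lemma abs_le_hnorm:
  assumes "f \<in> H" "x \<in> space S"
  shows "\<bar>f x\<bar> \<le> hnorm f"
proof -
  have "\<bar>f x\<bar> \<le> hnorm f * hnorm (kernel_section (space S) k x)"
    using Cauchy_Schwarz[OF assms(1) section_closed[OF assms(2)]] reproducing[OF assms] by simp
  also have "\<dots> \<le> hnorm f * 1"
    using hnorm_nonneg[OF assms(1)] hnorm_section_le_1[OF assms(2)] by (intro mult_left_mono)
  finally show ?thesis by simp
qed

lemma section_measurable:
  assumes "x \<in> space S"
  shows "kernel_section (space S) k x \<in> borel_measurable S"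
proof -
  have "k x \<in> borel_measurable S" using measurable_Pair2[OF kernel_measurable assms] by simp
  then show ?thesis by (simp add: kernel_section_def cong: measurable_cong)
qed

text \<open>
  The measurable elements of \<open>H\<close> form a subspace \<open>V\<close> that contains all kernel sections. The Riesz
  argument on \<open>V\<close>, applied to the functional \<open>\<langle>\<cdot>, f\<rangle>\<close>, gives an \<open>h\<close> in the closure of \<open>V\<close> with the same inner
  products as \<open>f\<close> against the sections, so \<open>h = f\<close> by the reproducing property. Norm convergence implies pointwise
  convergence, so \<open>f\<close> is a pointwise limit of measurable functions.
\<close>

lemma rkhs_borel_measurable:
  assumes f: "f \<in> H"
  shows "f \<in> borel_measurable S"
proof -
  define V where "V = H \<inter> borel_measurable S"
  obtain G h where G: "\<And>n. G n \<in> V" and h: "h \<in> H" "(\<lambda>n. hnorm (\<lambda>x. G n x - h x)) \<longlonglongrightarrow> 0"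
    and ip_h: "\<And>g. g \<in> V \<Longrightarrow> ip g h = ip g f"
  proof (rule Riesz_on_subspace[of V "\<lambda>g. ip g f" "hnorm f"])
    show "\<bar>ip g f\<bar> \<le> hnorm f * hnorm g" if "g \<in> V" for g
      using Cauchy_Schwarz[of g f] that f by (simp add: V_def mult.commute)
  qed (auto simp: V_def zero_closed add_closed scale_closed ip_add_left ip_scale_left f)
  have h_eq: "h x = f x" if x: "x \<in> space S" for x
  proof -
    have s: "kernel_section (space S) k x \<in> H" by (rule section_closed[OF x])
    have "ip (kernel_section (space S) k x) h = ip (kernel_section (space S) k x) f"
      by (rule ip_h) (simp add: V_def s section_measurable x)
    then show ?thesis
      using reproducing[OF h(1) x] reproducing[OF f x] ip_commute[OF s h(1)] ip_commute[OF s f]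
      by simp
  qed
  show ?thesis
  proof (rule borel_measurable_LIMSEQ_real)
    show "G n \<in> borel_measurable S" for n using G by (auto simp: V_def)
    fix x assume x: "x \<in> space S"
    have GH: "G n \<in> H" for n using G by (auto simp: V_def)
    from ip_tendsto[of G, OF GH h(1) section_closed[OF x] h(2)]
    show "(\<lambda>n. G n x) \<longlonglongrightarrow> f x"
      by (simp add: reproducing[OF GH x] reproducing[OF h(1) x] h_eq[OF x])
  qed
qed

lemma rkhs_integrable:
  assumes "f \<in> H" "Q \<in> space (prob_algebra S)"
  shows "integrable Q f"
proof -
  have Q: "prob_space Q" "sets Q = sets S" using assms(2) by (auto simp: space_prob_algebra)
  interpret prob_space Q by fact
  show ?thesis
  proof (rule integrable_const_bound[of _ "hnorm f"])
    show "f \<in> borel_measurable Q"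
      using rkhs_borel_measurable[OF assms(1)] Q(2) by (simp cong: measurable_cong_sets)
    show "AE x in Q. norm (f x) \<le> hnorm f"
      using abs_le_hnorm[OF assms(1)] sets_eq_imp_space_eq[OF Q(2)] by (intro AE_I2) simp
  qed
qed

abbreviation embedding :: "'x measure \<Rightarrow> 'x \<Rightarrow> real" where
  "embedding Q \<equiv> mean_embedding H ip Q"

text \<open>
  Integration against \<open>Q\<close> is a functional of norm at most one, as \<open>\<bar>f x\<bar> \<le> \<parallel>f\<parallel>\<close>. Its Riesz representer is unique,
  which justifies the definite description in the definition of the embedding.
\<close>

lemma mean_embedding_props:
  assumes Q: "Q \<in> space (prob_algebra S)"
  shows "embedding Q \<in> H \<and> (\<forall>f\<in>H. ip f (embedding Q) = (\<integral>x. f x \<partial>Q))"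
proof -
  have Q': "prob_space Q" "sets Q = sets S" using Q by (auto simp: space_prob_algebra)
  interpret prob_space Q by fact
  have bound: "\<bar>\<integral>x. f x \<partial>Q\<bar> \<le> 1 * hnorm f" if f: "f \<in> H" for f
  proof -
    have "\<bar>\<integral>x. f x \<partial>Q\<bar> \<le> (\<integral>x. \<bar>f x\<bar> \<partial>Q)" by (rule integral_abs_bound)
    also have "\<dots> \<le> hnorm f"
      using abs_le_hnorm[OF f] sets_eq_imp_space_eq[OF Q'(2)]
      by (intro integral_le_const integrable_abs rkhs_integrable[OF f Q] AE_I2) simp
    finally show ?thesis by simp
  qed
  obtain G h where h: "h \<in> H" "\<And>f. f \<in> H \<Longrightarrow> ip f h = (\<integral>x. f x \<partial>Q)"
    by (rule Riesz_on_subspace[of H "\<lambda>f. \<integral>x. f x \<partial>Q" 1])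
      (use bound in \<open>auto simp: zero_closed add_closed scale_closed rkhs_integrable Q\<close>)
  have unique: "h' = h" if h': "h' \<in> H" "\<And>f. f \<in> H \<Longrightarrow> ip f h' = (\<integral>x. f x \<partial>Q)" for h'
  proof -
    have "ip (\<lambda>x. h' x - h x) (\<lambda>x. h' x - h x) = 0"
      using h h' by (simp add: ip_diff_right diff_closed)
    then have "(\<lambda>x. h' x - h x) = (\<lambda>x. 0)" by (intro ip_definite diff_closed h' h)
    then show ?thesis by (auto simp: fun_eq_iff)
  qed
  have "embedding Q = h"
    unfolding mean_embedding_def
  proof (rule the_equality)
    show "h \<in> H \<and> (\<forall>f\<in>H. ip f h = (\<integral>x. f x \<partial>Q))" using h by blast
    show "h' = h" if "h' \<in> H \<and> (\<forall>f\<in>H. ip f h' = (\<integral>x. f x \<partial>Q))" for h'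
      by (rule unique) (use that in blast)+
  qed
  then show ?thesis using h by simp
qed

lemmas embedding_in = mean_embedding_props[THEN conjunct1]
lemmas ip_embedding = mean_embedding_props[THEN conjunct2, rule_format]

lemma embedding_eq:
  assumes Q: "Q \<in> space (prob_algebra S)" and x: "x \<in> space S"
  shows "embedding Q x = (\<integral>y. k x y \<partial>Q)"
proof -
  have "space Q = space S" using Q by (auto simp: space_prob_algebra dest: sets_eq_imp_space_eq)
  then have "(\<integral>y. k x y \<partial>Q) = (\<integral>y. kernel_section (space S) k x y \<partial>Q)"
    by (intro Bochner_Integration.integral_cong) (auto simp: kernel_section_def)
  also have "\<dots> = ip (kernel_section (space S) k x) (embedding Q)"
    by (rule ip_embedding[OF Q section_closed[OF x], symmetric])
  also have "\<dots> = embedding Q x"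
    using ip_commute[OF section_closed[OF x] embedding_in[OF Q]] reproducing[OF embedding_in[OF Q] x]
    by simp
  finally show ?thesis by simp
qed

lemma mmd_nonneg:
  assumes "P \<in> space (prob_algebra S)" "Q \<in> space (prob_algebra S)"
  shows "0 \<le> mmd H ip P Q"
  unfolding mmd_def by (intro hnorm_nonneg diff_closed embedding_in assms)

lemma mmd_commute:
  assumes "P \<in> space (prob_algebra S)" "Q \<in> space (prob_algebra S)"
  shows "mmd H ip P Q = mmd H ip Q P"
  unfolding mmd_def by (intro hnorm_minus_commute embedding_in assms)

lemma mmd_triangle:
  assumes "P \<in> space (prob_algebra S)" "Q \<in> space (prob_algebra S)" "R \<in> space (prob_algebra S)"
  shows "mmd H ip P R \<le> mmd H ip P Q + mmd H ip Q R"
proof -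
  have "hnorm (\<lambda>x. (embedding P x - embedding Q x) + (embedding Q x - embedding R x))
      \<le> mmd H ip P Q + mmd H ip Q R"
    unfolding mmd_def by (intro hnorm_triangle diff_closed embedding_in assms)
  then show ?thesis unfolding mmd_def by simp
qed

lemma mmd_square:
  assumes "P \<in> space (prob_algebra S)" "Q \<in> space (prob_algebra S)"
  shows "(mmd H ip P Q)\<^sup>2 = (\<integral>x. embedding P x \<partial>P) - 2 * (\<integral>x. embedding P x \<partial>Q) + (\<integral>x. embedding Q x \<partial>Q)"
proof -
  note in_H = embedding_in[OF assms(1)] embedding_in[OF assms(2)]
  show ?thesis
    unfolding mmd_def hnorm_square[OF diff_closed[OF in_H]] ip_diff_diff[OF in_H]
    by (simp only: ip_embedding[OF assms(1) in_H(1)] ip_embedding[OF assms(2) in_H(1)]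
        ip_embedding[OF assms(2) in_H(2)])
qed

lemma mmd_self: "P \<in> space (prob_algebra S) \<Longrightarrow> mmd H ip P P = 0"
  using mmd_square[of P P] by simp

end

context bounded_measurable_rkhs begin

text \<open>
  The quantity is \<open>\<integral>\<integral> k x y dL(z)(y) dK(z)(x)\<close>. Together with \<open>mmd_square\<close> this makes
  the discrepancy jointly measurable in the parameter and the sample, which is what the measurability of the
  posterior mass needs.
\<close>

lemma measurable_integral_embedding:
  assumes L: "L \<in> M \<rightarrow>\<^sub>M prob_algebra S" and K: "K \<in> M \<rightarrow>\<^sub>M prob_algebra S"
  shows "(\<lambda>z. \<integral>x. embedding (L z) x \<partial>K z) \<in> borel_measurable M"
proof -
  have "(\<lambda>w. \<integral>y. k (snd w) y \<partial>L (fst w)) \<in> borel_measurable (M \<Otimes>\<^sub>M S)"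
  proof (rule integral_measurable_kernel)
    show "(\<lambda>w. L (fst w)) \<in> M \<Otimes>\<^sub>M S \<rightarrow>\<^sub>M prob_algebra S"
      by (rule measurable_compose[OF measurable_fst L])
    have "(\<lambda>v. (snd (fst v), snd v)) \<in> (M \<Otimes>\<^sub>M S) \<Otimes>\<^sub>M S \<rightarrow>\<^sub>M S \<Otimes>\<^sub>M S" by measurable
    from measurable_compose[OF this kernel_measurable]
    show "(\<lambda>(w, y). k (snd w) y) \<in> borel_measurable ((M \<Otimes>\<^sub>M S) \<Otimes>\<^sub>M S)"
      by (simp add: case_prod_beta')
  qed
  then have "(\<lambda>z. \<integral>x. (\<integral>y. k x y \<partial>L z) \<partial>K z) \<in> borel_measurable M"
    by (intro integral_measurable_kernel[OF _ K]) (simp add: case_prod_beta')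
  moreover have "(\<integral>x. (\<integral>y. k x y \<partial>L z) \<partial>K z) = (\<integral>x. embedding (L z) x \<partial>K z)"
    if z: "z \<in> space M" for z
  proof -
    have "space (K z) = space S"
      using measurable_space[OF K z] by (auto simp: space_prob_algebra dest: sets_eq_imp_space_eq)
    then show ?thesis
      by (intro Bochner_Integration.integral_cong refl)
        (simp add: embedding_eq[OF measurable_space[OF L z]])
  qed
  ultimately show ?thesis by (simp cong: measurable_cong)
qed

lemma measurable_mmd:
  assumes L: "L \<in> M \<rightarrow>\<^sub>M prob_algebra S" and K: "K \<in> M \<rightarrow>\<^sub>M prob_algebra S"
  shows "(\<lambda>z. mmd H ip (L z) (K z)) \<in> borel_measurable M"
proof -
  have "(\<lambda>z. sqrt ((\<integral>x. embedding (L z) x \<partial>L z) - 2 * (\<integral>x. embedding (L z) x \<partial>K z)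
      + (\<integral>x. embedding (K z) x \<partial>K z))) \<in> borel_measurable M"
    by (intro measurable_compose[OF _ borel_measurable_sqrt] borel_measurable_add borel_measurable_diff
        borel_measurable_times borel_measurable_const measurable_integral_embedding L K)
  moreover have "sqrt ((\<integral>x. embedding (L z) x \<partial>L z) - 2 * (\<integral>x. embedding (L z) x \<partial>K z)
      + (\<integral>x. embedding (K z) x \<partial>K z)) = mmd H ip (L z) (K z)" if z: "z \<in> space M" for z
    unfolding mmd_square[OF measurable_space[OF L z] measurable_space[OF K z], symmetric]
    using mmd_nonneg[OF measurable_space[OF L z] measurable_space[OF K z]] by simp
  ultimately show ?thesis by (simp cong: measurable_cong)
qed

end

section \<open>The empirical measure\<close>

text \<open>
  As an image of the uniform distribution on the indices, the empirical measure inherits countable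
  additivity and its integrals become averages.
\<close>

lemma empirical_measure_eq_distr:
  assumes n: "n \<ge> 1" and x: "x \<in> {1..n} \<rightarrow> space S"
  shows "empirical_measure S n x = distr (uniform_count_measure {1..n}) S x"
proof -
  let ?U = "uniform_count_measure {1..n}"
  have x_meas: "x \<in> ?U \<rightarrow>\<^sub>M S"
    using x by (auto simp: measurable_def space_uniform_count_measure sets_uniform_count_measure)
  have "(\<Sum>i=1..n. emeasure (return S (x i)) A) / of_nat n = emeasure (distr ?U S x) A"
    if A: "A \<in> sets S" for A
  proof -
    have "(\<Sum>i=1..n. emeasure (return S (x i)) A) = (\<Sum>i=1..n. ennreal (indicator (x -` A) i))"
      by (intro sum.cong) (simp_all add: A indicator_def)
    also have "\<dots> = ennreal (\<Sum>i=1..n. indicator (x -` A) i)" by (intro sum_ennreal) simp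
    also have "(\<Sum>i=1..n. indicator (x -` A) i :: real) = real (card (x -` A \<inter> {1..n}))"
      by (simp add: indicator_def sum.If_cases Int_commute Collect_conj_eq vimage_def)
    finally have "(\<Sum>i=1..n. emeasure (return S (x i)) A) = ennreal (real (card (x -` A \<inter> {1..n})))" .
    moreover have "emeasure (distr ?U S x) A = ennreal (real (card (x -` A \<inter> {1..n})) / real n)"
      unfolding emeasure_distr[OF x_meas A] space_uniform_count_measure
      by (subst emeasure_uniform_count_measure) simp_all
    ultimately show ?thesis
      using n by (simp add: ennreal_of_nat_eq_real_of_nat divide_ennreal)
  qed
  then have "empirical_measure S n x = measure_of (space S) (sets S) (emeasure (distr ?U S x))"
    unfolding empirical_measure_def
    by (intro measure_of_eq) (auto simp: sets.space_closed sets.sigma_sets_eq)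
  also have "\<dots> = distr ?U S x"
    using measure_of_of_measure[of "distr ?U S x"] by simp
  finally show ?thesis .
qed

lemma empirical_measure_prob:
  assumes n: "n \<ge> 1" and x: "x \<in> {1..n} \<rightarrow> space S"
  shows "empirical_measure S n x \<in> space (prob_algebra S)"
proof -
  have "prob_space (uniform_count_measure {1..n})"
    using n by (intro prob_space_uniform_count_measure) auto
  moreover have "x \<in> uniform_count_measure {1..n} \<rightarrow>\<^sub>M S"
    using x by (auto simp: measurable_def space_uniform_count_measure sets_uniform_count_measure)
  ultimately show ?thesis
    unfolding empirical_measure_eq_distr[OF assms] space_prob_algebra
    by (auto intro: prob_space.prob_space_distr)
qed

lemma integral_empirical_measure:
  fixes f :: "'x \<Rightarrow> real"
  assumes n: "n \<ge> 1" and x: "x \<in> {1..n} \<rightarrow> space S" and f: "f \<in> borel_measurable S"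
  shows "(\<integral>y. f y \<partial>empirical_measure S n x) = (\<Sum>i=1..n. f (x i)) / real n"
proof -
  have "x \<in> uniform_count_measure {1..n} \<rightarrow>\<^sub>M S"
    using x by (auto simp: measurable_def space_uniform_count_measure sets_uniform_count_measure)
  then show ?thesis
    unfolding empirical_measure_eq_distr[OF n x]
    by (subst integral_distr[OF _ f]) (simp_all add: integral_uniform_count_measure)
qed

lemma measurable_empirical_measure:
  assumes n: "n \<ge> 1" and X: "\<And>i. i \<in> {1..n} \<Longrightarrow> X i \<in> \<Omega> \<rightarrow>\<^sub>M S"
  shows "(\<lambda>\<omega>. empirical_measure S n (\<lambda>i. X i \<omega>)) \<in> \<Omega> \<rightarrow>\<^sub>M prob_algebra S"
proof (rule measurable_prob_algebraI)
  have emp: "empirical_measure S n (\<lambda>i. X i \<omega>) \<in> space (prob_algebra S)" if "\<omega> \<in> space \<Omega>" for \<omega>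
    using measurable_space[OF X that] by (intro empirical_measure_prob[OF n]) simp
  then show prob: "prob_space (empirical_measure S n (\<lambda>i. X i \<omega>))" if "\<omega> \<in> space \<Omega>" for \<omega>
    using that by (simp add: space_prob_algebra)
  show "(\<lambda>\<omega>. empirical_measure S n (\<lambda>i. X i \<omega>)) \<in> \<Omega> \<rightarrow>\<^sub>M subprob_algebra S"
  proof (rule measurable_subprob_algebra)
    fix A assume A: "A \<in> sets S"
    have "(\<lambda>\<omega>. ennreal ((\<Sum>i=1..n. indicator A (X i \<omega>)) / real n)) \<in> borel_measurable \<Omega>"
    proof -
      have "(\<lambda>\<omega>. indicator A (X i \<omega>) :: real) \<in> borel_measurable \<Omega>" if "i \<in> {1..n}" for i
        by (rule measurable_compose[OF X[OF that]]) (use A in measurable)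
      then show ?thesis by (auto intro!: borel_measurable_divide borel_measurable_sum)
    qed
    moreover have "ennreal ((\<Sum>i=1..n. indicator A (X i \<omega>)) / real n)
        = emeasure (empirical_measure S n (\<lambda>i. X i \<omega>)) A" if \<omega>: "\<omega> \<in> space \<Omega>" for \<omega>
    proof -
      interpret E: prob_space "empirical_measure S n (\<lambda>i. X i \<omega>)" by (rule prob[OF \<omega>])
      have sets: "sets (empirical_measure S n (\<lambda>i. X i \<omega>)) = sets S"
        using emp[OF \<omega>] by (simp add: space_prob_algebra)
      have "A \<inter> space (empirical_measure S n (\<lambda>i. X i \<omega>)) = A"
        using A sets_eq_imp_space_eq[OF sets] sets.sets_into_space by auto
      then have "E.prob A = (\<integral>y. indicator A y \<partial>empirical_measure S n (\<lambda>i. X i \<omega>))" by simp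
      also have "\<dots> = (\<Sum>i=1..n. indicator A (X i \<omega>)) / real n"
        using measurable_space[OF X \<omega>] A by (intro integral_empirical_measure n) auto
      finally show ?thesis by (simp add: E.emeasure_eq_measure)
    qed
    ultimately show "(\<lambda>\<omega>. emeasure (empirical_measure S n (\<lambda>i. X i \<omega>)) A) \<in> borel_measurable \<Omega>"
      by (simp cong: measurable_cong)
  next
    fix \<omega> assume \<omega>: "\<omega> \<in> space \<Omega>"
    show "subprob_space (empirical_measure S n (\<lambda>i. X i \<omega>))"
      by (rule prob_space_imp_subprob_space[OF prob[OF \<omega>]])
    show "sets (empirical_measure S n (\<lambda>i. X i \<omega>)) = sets S"
      using emp[OF \<omega>] by (simp add: space_prob_algebra)
  qed
qed

section \<open>The sampling error of the empirical measure\<close>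

text \<open>
  Restricting an independent family to two disjoint singletons gives independence of two of its members,
  and hence a product law to which Fubini's theorem applies.
\<close>

lemma (in prob_space) indep_vars_pair_distr:
  assumes indep: "indep_vars (\<lambda>_. S) X I" and ij: "i \<in> I" "j \<in> I" "i \<noteq> j"
  shows "distr M (S \<Otimes>\<^sub>M S) (\<lambda>\<omega>. (X i \<omega>, X j \<omega>)) = distr M S (X i) \<Otimes>\<^sub>M distr M S (X j)"
proof -
  have "indep_var (PiM {i} (\<lambda>_. S)) (\<lambda>\<omega>. restrict (\<lambda>i. X i \<omega>) {i})
      (PiM {j} (\<lambda>_. S)) (\<lambda>\<omega>. restrict (\<lambda>i. X i \<omega>) {j})"
    using ij by (intro indep_var_restrict[OF indep]) auto
  from indep_var_compose[OF this measurable_component_singleton measurable_component_singleton]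
  have "indep_var S ((\<lambda>f. f i) \<circ> (\<lambda>\<omega>. restrict (\<lambda>i. X i \<omega>) {i}))
      S ((\<lambda>f. f j) \<circ> (\<lambda>\<omega>. restrict (\<lambda>i. X i \<omega>) {j}))" by simp
  then have "indep_var S (X i) S (X j)" by (simp add: comp_def)
  then show ?thesis by (simp add: indep_var_distribution_eq)
qed

context bounded_measurable_rkhs begin

text \<open>
  The inner product of \<open>k(x, \<cdot>) - \<mu>\<^sub>Q\<close> and \<open>k(y, \<cdot>) - \<mu>\<^sub>Q\<close>, where \<open>\<mu>\<^sub>Q\<close> is the mean embedding of \<open>Q\<close>.
\<close>

definition centred_kernel :: "'x measure \<Rightarrow> 'x \<Rightarrow> 'x \<Rightarrow> real" where
  "centred_kernel Q x y = k x y - embedding Q x - embedding Q y + (\<integral>z. embedding Q z \<partial>Q)"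

text \<open>
  The embedding of the empirical measure is the average of the sections at the sample points. The squared
  norm of its difference from \<open>\<mu>\<^sub>Q\<close> expands into the average of the inner products of the centred sections.
\<close>

lemma mmd_empirical_square:
  assumes Q: "Q \<in> space (prob_algebra S)" and n: "n \<ge> 1"
    and x: "x \<in> {1..n} \<rightarrow> space S"
  shows "(mmd H ip Q (empirical_measure S n x))\<^sup>2
    = (\<Sum>i=1..n. \<Sum>j=1..n. centred_kernel Q (x i) (x j)) / (real n)\<^sup>2"
proof -
  let ?E = "empirical_measure S n x"
  have E: "?E \<in> space (prob_algebra S)" by (rule empirical_measure_prob[OF n x])
  have emb_E: "embedding ?E y = (\<Sum>j=1..n. k y (x j)) / real n" if y: "y \<in> space S" for y
  proof -
    have "k y \<in> borel_measurable S" using measurable_Pair2[OF kernel_measurable y] by simp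
    then show ?thesis by (simp only: embedding_eq[OF E y] integral_empirical_measure[OF n x])
  qed
  have cross: "(\<integral>y. embedding Q y \<partial>?E) = (\<Sum>i=1..n. embedding Q (x i)) / real n"
    by (rule integral_empirical_measure[OF n x rkhs_borel_measurable[OF embedding_in[OF Q]]])
  have "(\<integral>y. embedding ?E y \<partial>?E) = (\<Sum>i=1..n. embedding ?E (x i)) / real n"
    by (rule integral_empirical_measure[OF n x rkhs_borel_measurable[OF embedding_in[OF E]]])
  also have "(\<Sum>i=1..n. embedding ?E (x i)) = (\<Sum>i=1..n. \<Sum>j=1..n. k (x i) (x j)) / real n"
    using x by (simp add: emb_E Pi_iff sum_divide_distrib)
  finally have diag: "(\<integral>y. embedding ?E y \<partial>?E) = (\<Sum>i=1..n. \<Sum>j=1..n. k (x i) (x j)) / (real n)\<^sup>2"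
    by (simp add: power2_eq_square)
  have "(\<Sum>i=1..n. \<Sum>j=1..n. centred_kernel Q (x i) (x j))
      = (\<Sum>i=1..n. \<Sum>j=1..n. k (x i) (x j)) - 2 * real n * (\<Sum>i=1..n. embedding Q (x i))
        + (real n)\<^sup>2 * (\<integral>z. embedding Q z \<partial>Q)"
    by (simp add: centred_kernel_def sum.distrib sum_subtractf sum_distrib_left[symmetric]
        power2_eq_square algebra_simps)
  then show ?thesis
    unfolding mmd_square[OF Q E] cross diag
    using n by (simp add: field_simps power2_eq_square)
qed

lemma centred_kernel_measurable:
  assumes Q: "Q \<in> space (prob_algebra S)"
  shows "(\<lambda>(x, y). centred_kernel Q x y) \<in> borel_measurable (S \<Otimes>\<^sub>M S)"
proof -
  note [measurable] = kernel_measurable rkhs_borel_measurable[OF embedding_in[OF Q]]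
  show ?thesis unfolding centred_kernel_def by measurable
qed

lemma centred_kernel_bounded:
  assumes Q: "Q \<in> space (prob_algebra S)" and x: "x \<in> space S" and y: "y \<in> space S"
  shows "\<bar>centred_kernel Q x y\<bar> \<le> 4"
proof -
  have Q': "prob_space Q" "sets Q = sets S" using Q by (auto simp: space_prob_algebra)
  interpret prob_space Q by fact
  have emb: "\<bar>embedding Q z\<bar> \<le> 1" if z: "z \<in> space S" for z
  proof -
    have "\<bar>\<integral>y. k z y \<partial>Q\<bar> \<le> (\<integral>y. \<bar>k z y\<bar> \<partial>Q)" by (rule integral_abs_bound)
    also have "\<dots> \<le> 1"
    proof (rule integral_le_const)
      have "k z \<in> borel_measurable Q"
        using measurable_Pair2[OF kernel_measurable z] Q'(2) by (simp cong: measurable_cong_sets)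
      then show "integrable Q (\<lambda>y. \<bar>k z y\<bar>)"
        using kernel_bounded[OF z] sets_eq_imp_space_eq[OF Q'(2)]
        by (intro integrable_abs integrable_const_bound[of _ 1] AE_I2) auto
      show "AE y in Q. \<bar>k z y\<bar> \<le> 1"
        using kernel_bounded[OF z] sets_eq_imp_space_eq[OF Q'(2)] by (intro AE_I2) simp
    qed
    finally show ?thesis by (simp add: embedding_eq[OF Q z])
  qed
  have "\<bar>\<integral>z. embedding Q z \<partial>Q\<bar> \<le> (\<integral>z. \<bar>embedding Q z\<bar> \<partial>Q)" by (rule integral_abs_bound)
  also have "\<dots> \<le> 1"
    using emb sets_eq_imp_space_eq[OF Q'(2)]
    by (intro integral_le_const integrable_abs rkhs_integrable embedding_in Q AE_I2) simp
  finally show ?thesis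
    using emb[OF x] emb[OF y] kernel_bounded[OF x y] by (simp add: centred_kernel_def)
qed

text \<open>
  A centred section has mean zero; this is what removes the off-diagonal terms.
\<close>

lemma integral_centred_kernel_right:
  assumes Q: "Q \<in> space (prob_algebra S)" and x: "x \<in> space S"
  shows "(\<integral>y. centred_kernel Q x y \<partial>Q) = 0"
proof -
  have Q': "prob_space Q" "sets Q = sets S" using Q by (auto simp: space_prob_algebra)
  interpret prob_space Q by fact
  have "k x \<in> borel_measurable Q"
    using measurable_Pair2[OF kernel_measurable x] Q'(2) by (simp cong: measurable_cong_sets)
  then have "integrable Q (k x)"
    using kernel_bounded[OF x] sets_eq_imp_space_eq[OF Q'(2)]
    by (intro integrable_const_bound[of _ 1] AE_I2) auto
  then show ?thesis
    by (simp add: centred_kernel_def rkhs_integrable embedding_in Q prob_space embedding_eq[OF Q x])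
qed

text \<open>
  The integral is the variance \<open>\<integral> k x x dQ - \<parallel>\<mu>\<^sub>Q\<parallel>\<^sup>2\<close> of a random section, and \<open>k x x \<le> 1\<close>.
\<close>

lemma integral_centred_kernel_diagonal:
  assumes Q: "Q \<in> space (prob_algebra S)"
  shows "(\<integral>x. centred_kernel Q x x \<partial>Q) \<le> 1"
proof -
  have Q': "prob_space Q" "sets Q = sets S" using Q by (auto simp: space_prob_algebra)
  interpret prob_space Q by fact
  have "(\<lambda>x. k x x) \<in> borel_measurable S"
    using measurable_compose[OF measurable_Pair[OF measurable_ident measurable_ident] kernel_measurable]
    by simp
  then have k_meas: "(\<lambda>x. k x x) \<in> borel_measurable Q" using Q'(2) by (simp cong: measurable_cong_sets)
  have k_le: "\<bar>k x x\<bar> \<le> 1" if "x \<in> space Q" for x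
    using kernel_bounded that sets_eq_imp_space_eq[OF Q'(2)] by simp
  have k_int: "integrable Q (\<lambda>x. k x x)"
    using k_meas k_le by (intro integrable_const_bound[of _ 1] AE_I2) auto
  have "(\<integral>x. k x x \<partial>Q) \<le> 1"
    using k_le by (intro integral_le_const k_int AE_I2) (auto simp: abs_le_iff)
  moreover have "0 \<le> (\<integral>z. embedding Q z \<partial>Q)"
    using ip_nonneg[OF embedding_in[OF Q]] by (simp add: ip_embedding[OF Q embedding_in[OF Q]])
  moreover have "(\<integral>x. centred_kernel Q x x \<partial>Q) = (\<integral>x. k x x \<partial>Q) - (\<integral>z. embedding Q z \<partial>Q)"
    by (simp add: centred_kernel_def k_int rkhs_integrable embedding_in Q prob_space)
  ultimately show ?thesis by simp
qed

lemma expectation_mmd_empirical: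
  assumes \<Omega>: "prob_space \<Omega>" and indep: "prob_space.indep_vars \<Omega> (\<lambda>_. S) X {1..}"
    and distr: "\<And>i. i \<ge> 1 \<Longrightarrow> distr \<Omega> S (X i) = Q"
    and Q: "Q \<in> space (prob_algebra S)" and n: "n \<ge> 1"
  shows "integrable \<Omega> (\<lambda>\<omega>. (mmd H ip Q (empirical_measure S n (\<lambda>i. X i \<omega>)))\<^sup>2)"
    and "(\<integral>\<omega>. (mmd H ip Q (empirical_measure S n (\<lambda>i. X i \<omega>)))\<^sup>2 \<partial>\<Omega>) \<le> 1 / real n"
proof -
  interpret prob_space \<Omega> by fact
  have Q': "prob_space Q" "sets Q = sets S" using Q by (auto simp: space_prob_algebra)
  have X: "X i \<in> \<Omega> \<rightarrow>\<^sub>M S" if "i \<ge> 1" for i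
    using indep that by (auto simp: indep_vars_def)
  let ?c = "\<lambda>i j \<omega>. centred_kernel Q (X i \<omega>) (X j \<omega>)"
  have mmd_eq: "(mmd H ip Q (empirical_measure S n (\<lambda>i. X i \<omega>)))\<^sup>2
      = (\<Sum>i=1..n. \<Sum>j=1..n. ?c i j \<omega>) / (real n)\<^sup>2" if "\<omega> \<in> space \<Omega>" for \<omega>
    using measurable_space[OF X that] by (intro mmd_empirical_square[OF Q n]) simp
  have c_meas: "?c i j \<in> borel_measurable \<Omega>" if "i \<ge> 1" "j \<ge> 1" for i j
    using measurable_compose[OF measurable_Pair[OF X[OF that(1)] X[OF that(2)]]
        centred_kernel_measurable[OF Q]]
    by simp
  have c_int: "integrable \<Omega> (?c i j)" if "i \<ge> 1" "j \<ge> 1" for i j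
    using centred_kernel_bounded[OF Q] measurable_space[OF X[OF that(1)]] measurable_space[OF X[OF that(2)]]
    by (intro integrable_const_bound[of _ 4] c_meas that AE_I2) simp
  have sum_int: "integrable \<Omega> (\<lambda>\<omega>. (\<Sum>i=1..n. \<Sum>j=1..n. ?c i j \<omega>) / (real n)\<^sup>2)"
    by (intro integrable_divide_zero Bochner_Integration.integrable_sum c_int impI) auto
  then show "integrable \<Omega> (\<lambda>\<omega>. (mmd H ip Q (empirical_measure S n (\<lambda>i. X i \<omega>)))\<^sup>2)"
    by (subst Bochner_Integration.integrable_cong[OF refl mmd_eq])
  have off_diagonal: "(\<integral>\<omega>. ?c i j \<omega> \<partial>\<Omega>) = 0" if ij: "i \<ge> 1" "j \<ge> 1" "i \<noteq> j" for i j
  proof -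
    interpret QQ: pair_prob_space Q Q using Q'(1)
      by (simp add: pair_prob_space_def pair_sigma_finite_def prob_space_imp_sigma_finite)
    have sets_QQ: "sets (Q \<Otimes>\<^sub>M Q) = sets (S \<Otimes>\<^sub>M S)" by (intro sets_pair_measure_cong Q')
    have meas: "(\<lambda>(x, y). centred_kernel Q x y) \<in> borel_measurable (Q \<Otimes>\<^sub>M Q)"
      using centred_kernel_measurable[OF Q] by (simp cong: measurable_cong_sets[OF sets_QQ refl])
    have "(\<integral>\<omega>. ?c i j \<omega> \<partial>\<Omega>)
        = (\<integral>z. (\<lambda>(x, y). centred_kernel Q x y) z \<partial>distr \<Omega> (S \<Otimes>\<^sub>M S) (\<lambda>\<omega>. (X i \<omega>, X j \<omega>)))"
      by (subst integral_distr[OF measurable_Pair[OF X[OF ij(1)] X[OF ij(2)]] centred_kernel_measurable[OF Q]]) simp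
    also have "distr \<Omega> (S \<Otimes>\<^sub>M S) (\<lambda>\<omega>. (X i \<omega>, X j \<omega>)) = Q \<Otimes>\<^sub>M Q"
      using indep_vars_pair_distr[OF indep, of i j] ij by (simp add: distr)
    also have "(\<integral>z. (\<lambda>(x, y). centred_kernel Q x y) z \<partial>(Q \<Otimes>\<^sub>M Q))
        = (\<integral>x. (\<integral>y. centred_kernel Q x y \<partial>Q) \<partial>Q)"
    proof (subst QQ.integral_fst'[symmetric])
      show "integrable (Q \<Otimes>\<^sub>M Q) (\<lambda>(x, y). centred_kernel Q x y)"
        using centred_kernel_bounded[OF Q] sets_eq_imp_space_eq[OF sets_QQ]
        by (intro QQ.integrable_const_bound[of _ 4] meas AE_I2) (auto simp: space_pair_measure)
    qed simp
    also have "\<dots> = (\<integral>x. 0 \<partial>Q)"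
      using sets_eq_imp_space_eq[OF Q'(2)]
      by (intro Bochner_Integration.integral_cong refl) (simp add: integral_centred_kernel_right[OF Q])
    finally show ?thesis by simp
  qed
  have diagonal: "(\<integral>\<omega>. ?c i i \<omega> \<partial>\<Omega>) \<le> 1" if i: "i \<ge> 1" for i
  proof -
    have "(\<lambda>x. centred_kernel Q x x) \<in> borel_measurable S"
      using measurable_compose[OF measurable_Pair[OF measurable_ident measurable_ident] centred_kernel_measurable[OF Q]]
      by simp
    then have "(\<integral>\<omega>. ?c i i \<omega> \<partial>\<Omega>) = (\<integral>x. centred_kernel Q x x \<partial>distr \<Omega> S (X i))"
      by (intro integral_distr[OF X[OF i], symmetric])
    then show ?thesis using integral_centred_kernel_diagonal[OF Q] by (simp add: distr[OF i])
  qed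
  have "(\<integral>\<omega>. (mmd H ip Q (empirical_measure S n (\<lambda>i. X i \<omega>)))\<^sup>2 \<partial>\<Omega>)
      = (\<integral>\<omega>. (\<Sum>i=1..n. \<Sum>j=1..n. ?c i j \<omega>) / (real n)\<^sup>2 \<partial>\<Omega>)"
    by (rule Bochner_Integration.integral_cong[OF refl mmd_eq])
  also have "\<dots> = (\<Sum>i=1..n. \<Sum>j=1..n. (\<integral>\<omega>. ?c i j \<omega> \<partial>\<Omega>)) / (real n)\<^sup>2"
  proof -
    have "(\<integral>\<omega>. (\<Sum>i=1..n. \<Sum>j=1..n. ?c i j \<omega>) \<partial>\<Omega>) = (\<Sum>i=1..n. (\<integral>\<omega>. (\<Sum>j=1..n. ?c i j \<omega>) \<partial>\<Omega>))"
      by (intro Bochner_Integration.integral_sum Bochner_Integration.integrable_sum c_int) auto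
    also have "\<dots> = (\<Sum>i=1..n. \<Sum>j=1..n. (\<integral>\<omega>. ?c i j \<omega> \<partial>\<Omega>))"
      by (intro sum.cong refl Bochner_Integration.integral_sum c_int) auto
    finally show ?thesis by simp
  qed
  also have "\<dots> \<le> (\<Sum>i=1..n. \<Sum>j=1..n. if i = j then 1 else 0) / (real n)\<^sup>2"
    using off_diagonal diagonal by (intro divide_right_mono sum_mono) auto
  also have "\<dots> = 1 / real n" using n by (simp add: power2_eq_square)
  finally show "(\<integral>\<omega>. (mmd H ip Q (empirical_measure S n (\<lambda>i. X i \<omega>)))\<^sup>2 \<partial>\<Omega>) \<le> 1 / real n" .
qed

lemma prob_mmd_empirical_gt:
  assumes \<Omega>: "prob_space \<Omega>" and indep: "prob_space.indep_vars \<Omega> (\<lambda>_. S) X {1..}"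
    and distr: "\<And>i. i \<ge> 1 \<Longrightarrow> distr \<Omega> S (X i) = Q"
    and Q: "Q \<in> space (prob_algebra S)" and n: "n \<ge> 1" and a: "a > 0"
  shows "measure \<Omega> {\<omega> \<in> space \<Omega>. mmd H ip Q (empirical_measure S n (\<lambda>i. X i \<omega>)) > a}
    \<le> 1 / (real n * a\<^sup>2)"
proof -
  interpret prob_space \<Omega> by fact
  let ?d = "\<lambda>\<omega>. mmd H ip Q (empirical_measure S n (\<lambda>i. X i \<omega>))"
  note int = expectation_mmd_empirical(1)[OF \<Omega> indep distr Q n]
  have "measure \<Omega> {\<omega> \<in> space \<Omega>. ?d \<omega> > a} \<le> measure \<Omega> {\<omega> \<in> space \<Omega>. (?d \<omega>)\<^sup>2 \<ge> a\<^sup>2}"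
    using a borel_measurable_integrable[OF int]
    by (intro finite_measure_mono) (auto intro!: power_mono)
  also have "\<dots> \<le> (\<integral>\<omega>. (?d \<omega>)\<^sup>2 \<partial>\<Omega>) / a\<^sup>2"
    using a by (intro integral_Markov_inequality_measure[OF int, of "{}"]) auto
  also have "\<dots> \<le> (1 / real n) / a\<^sup>2"
    by (intro divide_right_mono expectation_mmd_empirical(2)[OF \<Omega> indep distr Q n]) auto
  finally show ?thesis by simp
qed

end

section \<open>Gibbs posteriors\<close>

lemma measure_normalised_density:
  fixes e :: "'t \<Rightarrow> real"
  assumes e: "e \<in> borel_measurable \<pi>" "\<And>\<theta>. 0 \<le> e \<theta>" and Z: "0 \<le> Z" and A: "A \<in> sets \<pi>"
  shows "measure (density \<pi> (\<lambda>\<theta>. ennreal (e \<theta> / Z))) A = (\<integral>\<theta>. indicator A \<theta> * e \<theta> \<partial>\<pi>) / Z"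
proof -
  let ?D = "density \<pi> (\<lambda>\<theta>. ennreal (e \<theta> / Z))"
  have "measure ?D A = (\<integral>\<theta>. indicator A \<theta> \<partial>?D)"
    using sets.sets_into_space[OF A] by (simp add: Int_absorb2)
  also have "\<dots> = (\<integral>\<theta>. (e \<theta> / Z) *\<^sub>R indicator A \<theta> \<partial>\<pi>)"
    using e Z A by (intro integral_density AE_I2) auto
  also have "\<dots> = (\<integral>\<theta>. (indicator A \<theta> * e \<theta>) / Z \<partial>\<pi>)"
    by (intro Bochner_Integration.integral_cong) (auto simp: mult.commute)
  finally show ?thesis by simp
qed

text \<open>
  The numerator is at most \<open>exp (- \<beta> a)\<close> times the prior mass of \<open>A\<close>, the normalising constant at least
  \<open>exp (- \<beta> b)\<close> times that of \<open>B\<close>. The factor \<open>t\<close> comes from disjointness: the prior mass of \<open>A\<close>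
  is at most \<open>1 - exp (- t) \<le> t\<close>. It keeps the bound useful when \<open>t\<close> is small.
\<close>

lemma Gibbs_mass_bound:
  fixes L :: "'t \<Rightarrow> real"
  assumes \<pi>: "prob_space \<pi>" and L: "L \<in> borel_measurable \<pi>" "\<And>\<theta>. \<theta> \<in> space \<pi> \<Longrightarrow> 0 \<le> L \<theta>" and \<beta>: "\<beta> > 0"
    and A: "A \<in> sets \<pi>" "\<And>\<theta>. \<theta> \<in> A \<Longrightarrow> a \<le> L \<theta>"
    and B: "B \<in> sets \<pi>" "\<And>\<theta>. \<theta> \<in> B \<Longrightarrow> L \<theta> \<le> b"
    and disj: "A \<inter> B = {}" and mass: "exp (- t) \<le> measure \<pi> B"
  shows "(\<integral>\<theta>. indicator A \<theta> * exp (- \<beta> * L \<theta>) \<partial>\<pi>) / (\<integral>\<theta>. exp (- \<beta> * L \<theta>) \<partial>\<pi>)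
    \<le> t * exp (- (\<beta> * (a - b) - t))"
proof -
  interpret prob_space \<pi> by fact
  have e_int: "integrable \<pi> (\<lambda>\<theta>. exp (- \<beta> * L \<theta>))"
    using L \<beta> by (intro integrable_const_bound[of _ 1] AE_I2) auto
  have ind_int: "integrable \<pi> (\<lambda>\<theta>. indicator C \<theta> * exp (- \<beta> * L \<theta>))" if "C \<in> sets \<pi>" for C
    using integrable_mult_indicator[OF that e_int] by simp
  have const_int: "integrable \<pi> (\<lambda>\<theta>. indicator C \<theta> * c)" if "C \<in> sets \<pi>" for C and c :: real
    using that by (intro integrable_mult_left integrable_indicator) (auto simp: emeasure_eq_measure)
  have const_val: "(\<integral>\<theta>. indicator C \<theta> * c \<partial>\<pi>) = measure \<pi> C * c" if "C \<in> sets \<pi>" for C and c :: real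
    using sets.sets_into_space[OF that] by (simp add: Int_absorb2)
  have "measure \<pi> A + measure \<pi> B \<le> 1"
    using finite_measure_Union[OF A(1) B(1) disj] prob_le_1[of "A \<union> B"] by simp
  then have A_mass: "measure \<pi> A \<le> t"
    using mass exp_ge_add_one_self[of "- t"] by linarith
  then have t: "0 \<le> t" using measure_nonneg[of \<pi> A] by linarith
  have num: "(\<integral>\<theta>. indicator A \<theta> * exp (- \<beta> * L \<theta>) \<partial>\<pi>) \<le> t * exp (- \<beta> * a)"
  proof -
    have "(\<integral>\<theta>. indicator A \<theta> * exp (- \<beta> * L \<theta>) \<partial>\<pi>) \<le> (\<integral>\<theta>. indicator A \<theta> * exp (- \<beta> * a) \<partial>\<pi>)"
      using A(2) \<beta> by (intro integral_mono ind_int const_int A(1)) (auto simp: indicator_def)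
    also have "\<dots> = measure \<pi> A * exp (- \<beta> * a)" by (rule const_val[OF A(1)])
    also have "\<dots> \<le> t * exp (- \<beta> * a)" by (intro mult_right_mono A_mass) simp
    finally show ?thesis .
  qed
  have den: "exp (- t) * exp (- \<beta> * b) \<le> (\<integral>\<theta>. exp (- \<beta> * L \<theta>) \<partial>\<pi>)"
  proof -
    have "exp (- t) * exp (- \<beta> * b) \<le> measure \<pi> B * exp (- \<beta> * b)"
      by (intro mult_right_mono mass) simp
    also have "\<dots> = (\<integral>\<theta>. indicator B \<theta> * exp (- \<beta> * b) \<partial>\<pi>)" by (rule const_val[OF B(1), symmetric])
    also have "\<dots> \<le> (\<integral>\<theta>. exp (- \<beta> * L \<theta>) \<partial>\<pi>)"
      using B(2) \<beta> by (intro integral_mono e_int const_int B(1)) (auto simp: indicator_def)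
    finally show ?thesis .
  qed
  have "(\<integral>\<theta>. indicator A \<theta> * exp (- \<beta> * L \<theta>) \<partial>\<pi>) / (\<integral>\<theta>. exp (- \<beta> * L \<theta>) \<partial>\<pi>)
      \<le> (t * exp (- \<beta> * a)) / (exp (- t) * exp (- \<beta> * b))"
    using t by (intro frac_le num den) auto
  also have "\<dots> = t * exp (- (\<beta> * (a - b) - t))"
    by (simp add: exp_add[symmetric] exp_diff[symmetric] algebra_simps flip: times_divide_eq_right)
  finally show ?thesis .
qed

section \<open>Concentration of the posterior\<close>

context bounded_measurable_rkhs begin

context
  fixes T \<pi> :: "'t measure" and P :: "'t \<Rightarrow> 'x measure"
  assumes model: "P \<in> T \<rightarrow>\<^sub>M prob_algebra S"
    and prior: "prob_space \<pi>" "sets \<pi> = sets T"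
begin

lemma mmd_superlevel_set:
  assumes Q: "Q \<in> space (prob_algebra S)"
  shows "{\<theta> \<in> space T. mmd H ip (P \<theta>) Q > c} \<in> sets \<pi>"
    and "{\<theta> \<in> space T. mmd H ip (P \<theta>) Q \<le> c} \<in> sets \<pi>"
proof -
  have [measurable]: "(\<lambda>\<theta>. mmd H ip (P \<theta>) Q) \<in> borel_measurable T"
    by (intro measurable_mmd model measurable_const Q)
  show "{\<theta> \<in> space T. mmd H ip (P \<theta>) Q > c} \<in> sets \<pi>"
    and "{\<theta> \<in> space T. mmd H ip (P \<theta>) Q \<le> c} \<in> sets \<pi>"
    unfolding prior(2) by measurable
qed

lemma measure_mmd_posterior:
  assumes Q: "Q \<in> space (prob_algebra S)" and A: "A \<in> sets \<pi>"
  shows "measure (mmd_posterior H ip P \<pi> \<beta> Q) A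
    = (\<integral>\<theta>. indicator A \<theta> * exp (- \<beta> * (mmd H ip (P \<theta>) Q)\<^sup>2) \<partial>\<pi>)
      / (\<integral>\<theta>. exp (- \<beta> * (mmd H ip (P \<theta>) Q)\<^sup>2) \<partial>\<pi>)"
  unfolding mmd_posterior_def
proof (rule measure_normalised_density[OF _ _ _ A])
  have "(\<lambda>\<theta>. mmd H ip (P \<theta>) Q) \<in> borel_measurable T"
    by (intro measurable_mmd model measurable_const Q)
  then have [measurable]: "(\<lambda>\<theta>. mmd H ip (P \<theta>) Q) \<in> borel_measurable \<pi>"
    using prior(2) by (simp cong: measurable_cong_sets)
  show "(\<lambda>\<theta>. exp (- \<beta> * (mmd H ip (P \<theta>) Q)\<^sup>2)) \<in> borel_measurable \<pi>" by measurable
qed simp_all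

text \<open>
  The triangle inequality bounds the loss below by \<open>(3 M r / 4)\<^sup>2\<close> on the bad set and above by
  \<open>(r + M r / 4)\<^sup>2\<close> on the neighbourhood. With \<open>t = \<beta> r\<^sup>2\<close> the Gibbs bound is
  \<open>t exp (- t (M\<^sup>2 / 2 - M / 2 - 2))\<close>, and the subtracted exponent is at least \<open>t M\<^sup>2 / 4\<close> from \<open>M = 4\<close> on.
\<close>

lemma posterior_mass_bound:
  assumes P0: "P0 \<in> space (prob_algebra S)" and Q: "Q \<in> space (prob_algebra S)"
    and \<beta>: "\<beta> > 0" and r: "r > 0" and M: "M \<ge> 4"
    and mass: "exp (- \<beta> * r\<^sup>2) \<le> measure \<pi> {\<theta> \<in> space T. mmd H ip (P \<theta>) P0 \<le> r}"
    and close: "mmd H ip P0 Q \<le> M * r / 4"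
  shows "measure (mmd_posterior H ip P \<pi> \<beta> Q) {\<theta> \<in> space T. mmd H ip (P \<theta>) P0 > M * r} \<le> 4 / M\<^sup>2"
proof -
  define t where "t = \<beta> * r\<^sup>2"
  have t: "t > 0" using \<beta> r by (simp add: t_def)
  let ?A = "{\<theta> \<in> space T. mmd H ip (P \<theta>) P0 > M * r}"
  let ?B = "{\<theta> \<in> space T. mmd H ip (P \<theta>) P0 \<le> r}"
  have P: "P \<theta> \<in> space (prob_algebra S)" if "\<theta> \<in> space T" for \<theta>
    by (rule measurable_space[OF model that])
  have "(\<lambda>\<theta>. mmd H ip (P \<theta>) Q) \<in> borel_measurable T"
    by (intro measurable_mmd model measurable_const Q)
  then have [measurable]: "(\<lambda>\<theta>. mmd H ip (P \<theta>) Q) \<in> borel_measurable \<pi>"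
    using prior(2) by (simp cong: measurable_cong_sets)
  have "measure (mmd_posterior H ip P \<pi> \<beta> Q) ?A
      \<le> t * exp (- (\<beta> * ((3 / 4 * M * r)\<^sup>2 - (r + M * r / 4)\<^sup>2) - t))"
    unfolding measure_mmd_posterior[OF Q mmd_superlevel_set(1)[OF P0]]
  proof (rule Gibbs_mass_bound[OF prior(1) _ _ \<beta> mmd_superlevel_set(1)[OF P0] _ mmd_superlevel_set(2)[OF P0]])
    show "(\<lambda>\<theta>. (mmd H ip (P \<theta>) Q)\<^sup>2) \<in> borel_measurable \<pi>" by measurable
    show "(3 / 4 * M * r)\<^sup>2 \<le> (mmd H ip (P \<theta>) Q)\<^sup>2" if \<theta>: "\<theta> \<in> ?A" for \<theta>
    proof (rule power_mono)
      have "mmd H ip (P \<theta>) P0 \<le> mmd H ip (P \<theta>) Q + mmd H ip Q P0"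
        using \<theta> by (intro mmd_triangle P Q P0) simp
      then show "3 / 4 * M * r \<le> mmd H ip (P \<theta>) Q"
        using \<theta> close mmd_commute[OF P0 Q] by simp
      show "0 \<le> 3 / 4 * M * r" using M r by simp
    qed
    show "(mmd H ip (P \<theta>) Q)\<^sup>2 \<le> (r + M * r / 4)\<^sup>2" if \<theta>: "\<theta> \<in> ?B" for \<theta>
    proof (rule power_mono)
      have "mmd H ip (P \<theta>) Q \<le> mmd H ip (P \<theta>) P0 + mmd H ip P0 Q"
        using \<theta> by (intro mmd_triangle P Q P0) simp
      then show "mmd H ip (P \<theta>) Q \<le> r + M * r / 4" using \<theta> close by simp
      show "0 \<le> mmd H ip (P \<theta>) Q" using \<theta> by (intro mmd_nonneg P Q) simp
    qed
    have "r \<le> M * r" using M r by simp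
    then show "?A \<inter> ?B = {}" by auto
    show "exp (- t) \<le> measure \<pi> ?B" using mass by (simp add: t_def)
  qed simp
  also have "\<dots> \<le> t * exp (- (t * (M\<^sup>2 / 4)))"
  proof -
    have "0 \<le> (M - 4) * (M + 2)" using M by simp
    then have "M\<^sup>2 / 4 \<le> M\<^sup>2 / 2 - M / 2 - 2" by (simp add: power2_eq_square algebra_simps)
    then have "t * (M\<^sup>2 / 4) \<le> t * (M\<^sup>2 / 2 - M / 2 - 2)" using t by simp
    also have "\<dots> = \<beta> * ((3 / 4 * M * r)\<^sup>2 - (r + M * r / 4)\<^sup>2) - t"
      by (simp add: t_def power2_eq_square field_simps)
    finally show ?thesis using t by simp
  qed
  also have "\<dots> \<le> 4 / M\<^sup>2"
  proof -
    have M2: "M\<^sup>2 > 0" using M by simp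
    \<comment> \<open>\<open>s exp (- s) \<le> 1\<close> at \<open>s = t M\<^sup>2 / 4\<close> gives a bound that is uniform in \<open>t\<close>.\<close>
    have "t * (M\<^sup>2 / 4) \<le> exp (t * (M\<^sup>2 / 4))" using exp_ge_add_one_self[of "t * (M\<^sup>2 / 4)"] by linarith
    then show ?thesis using M2 by (simp add: exp_minus field_simps)
  qed
  finally show ?thesis .
qed

lemma measurable_posterior_mass:
  assumes Q: "Q \<in> \<Omega> \<rightarrow>\<^sub>M prob_algebra S" and A: "A \<in> sets \<pi>"
  shows "(\<lambda>\<omega>. measure (mmd_posterior H ip P \<pi> \<beta> (Q \<omega>)) A) \<in> borel_measurable \<Omega>"
proof -
  interpret prob_space \<pi> by (rule prior(1))
  have P\<pi>: "P \<in> \<pi> \<rightarrow>\<^sub>M prob_algebra S" using model prior(2) by (simp cong: measurable_cong_sets)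
  have [measurable]: "(\<lambda>z. mmd H ip (P (snd z)) (Q (fst z))) \<in> borel_measurable (\<Omega> \<Otimes>\<^sub>M \<pi>)"
    by (intro measurable_mmd measurable_compose[OF measurable_snd P\<pi>] measurable_compose[OF measurable_fst Q])
  note [measurable] = A
  have "(\<lambda>\<omega>. (\<integral>\<theta>. indicator A \<theta> * exp (- \<beta> * (mmd H ip (P \<theta>) (Q \<omega>))\<^sup>2) \<partial>\<pi>)
      / (\<integral>\<theta>. exp (- \<beta> * (mmd H ip (P \<theta>) (Q \<omega>))\<^sup>2) \<partial>\<pi>)) \<in> borel_measurable \<Omega>"
    by (intro borel_measurable_divide borel_measurable_lebesgue_integral)
      (unfold case_prod_beta', measurable)
  then show ?thesis
    by (rule measurable_cong[THEN iffD1, rotated])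
      (rule measure_mmd_posterior[OF measurable_space[OF Q] A, symmetric])
qed

end

text \<open>
  The true parameter attains discrepancy zero, hence so does every minimiser, and the inner product is definite.
\<close>

lemma argmin_mmd_well_specified:
  assumes P: "P \<in> space T \<rightarrow> space (prob_algebra S)" and P0: "P0 \<in> P ` space T"
    and argmin: "is_arg_min (\<lambda>\<theta>. mmd H ip (P \<theta>) P0) (\<lambda>\<theta>. \<theta> \<in> space T) \<theta>s"
  shows "embedding (P \<theta>s) = embedding P0"
proof -
  obtain \<theta>0 where \<theta>0: "\<theta>0 \<in> space T" "P0 = P \<theta>0" using P0 by blast
  have P0': "P0 \<in> space (prob_algebra S)" using \<theta>0 P by auto
  have \<theta>s: "\<theta>s \<in> space T" "mmd H ip (P \<theta>s) P0 \<le> mmd H ip (P \<theta>0) P0"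
    using argmin \<theta>0(1) by (auto simp: is_arg_min_linorder)
  have P\<theta>s: "P \<theta>s \<in> space (prob_algebra S)" using \<theta>s P by auto
  have "mmd H ip (P \<theta>s) P0 = 0"
    using \<theta>s(2) mmd_self[OF P0'] mmd_nonneg[OF P\<theta>s P0'] \<theta>0(2) by simp
  then have "ip (\<lambda>x. embedding (P \<theta>s) x - embedding P0 x) (\<lambda>x. embedding (P \<theta>s) x - embedding P0 x) = 0"
    by (simp add: mmd_def ip_norm_def)
  then have "(\<lambda>x. embedding (P \<theta>s) x - embedding P0 x) = (\<lambda>x. 0)"
    by (intro ip_definite diff_closed embedding_in P\<theta>s P0')
  then show ?thesis by (auto simp: fun_eq_iff)
qed

end

theorem theorem2:
  fixes S :: "'x measure"
    and k :: "'x \<Rightarrow> 'x \<Rightarrow> real"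
    and H :: "('x \<Rightarrow> real) set"
    and ip :: "('x \<Rightarrow> real) \<Rightarrow> ('x \<Rightarrow> real) \<Rightarrow> real"
    and \<Omega> :: "'w measure"
    and X :: "nat \<Rightarrow> 'w \<Rightarrow> 'x"
    and P0 :: "'x measure"
    and T :: "'t measure"
    and P :: "'t \<Rightarrow> 'x measure"
    and \<theta>s :: 't
    and \<pi> :: "'t measure"
    and \<beta> M :: "nat \<Rightarrow> real"
  assumes k_measurable: "(\<lambda>(x, y). k x y) \<in> borel_measurable (S \<Otimes>\<^sub>M S)"
    and k_pd: "positive_definite_kernel (space S) k"
    and k_bounded: "\<forall>x\<in>space S. \<forall>y\<in>space S. \<bar>k x y\<bar> \<le> 1"
    and k_ispd: "integrally_strictly_pd S k"
    and H_rkhs: "rkhs (space S) k H ip"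
    and P0_prob: "prob_space P0" "sets P0 = sets S"
    and model: "P \<in> T \<rightarrow>\<^sub>M prob_algebra S"
    and sample_space: "prob_space \<Omega>"
    and X_indep: "prob_space.indep_vars \<Omega> (\<lambda>_. S) X {1..}"
    and X_distr: "\<forall>i\<ge>1. distr \<Omega> S (X i) = P0"
    and well_specified: "P0 \<in> P ` space T"
    and \<theta>s_argmin: "is_arg_min (\<lambda>\<theta>. mmd H ip (P \<theta>) P0) (\<lambda>\<theta>. \<theta> \<in> space T) \<theta>s"
    and prior: "prob_space \<pi>" "sets \<pi> = sets T"
    and \<beta>_pos: "\<forall>n\<ge>1. \<beta> n > 0"
    and prior_mass: "\<forall>n\<ge>1.
          measure \<pi> {\<theta> \<in> space T. mmd H ip (P \<theta>) (P \<theta>s) \<le> real n powr (-1/2)}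
            \<ge> exp (- \<beta> n / real n)"
    and M_pos: "\<forall>n\<ge>1. M n > 0"
    and M_infinity: "filterlim M at_top sequentially"
  shows "converges_in_probability \<Omega>
           (\<lambda>n \<omega>. measure (mmd_posterior H ip P \<pi> (\<beta> n) (empirical_measure S n (\<lambda>i. X i \<omega>)))
                     {\<theta> \<in> space T. mmd H ip (P \<theta>) P0 > M n * real n powr (-1/2)})
           0"
proof -
  interpret bounded_measurable_rkhs S k H ip
    using H_rkhs k_measurable k_bounded
    by (simp add: bounded_measurable_rkhs_def bounded_measurable_rkhs_axioms_def)
  interpret prob_space \<Omega> by fact
  let ?r = "\<lambda>n. real n powr (-1/2)"
  let ?E = "\<lambda>n \<omega>. empirical_measure S n (\<lambda>i. X i \<omega>)"
  let ?A = "\<lambda>n. {\<theta> \<in> space T. mmd H ip (P \<theta>) P0 > M n * ?r n}"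
  let ?Y = "\<lambda>n \<omega>. measure (mmd_posterior H ip P \<pi> (\<beta> n) (?E n \<omega>)) (?A n)"
  have P0: "P0 \<in> space (prob_algebra S)" using P0_prob by (simp add: space_prob_algebra)
  have X: "X i \<in> \<Omega> \<rightarrow>\<^sub>M S" if "i \<ge> 1" for i
    using X_indep that by (auto simp: indep_vars_def)
  have E_meas: "?E n \<in> \<Omega> \<rightarrow>\<^sub>M prob_algebra S" if "n \<ge> 1" for n
    using X by (intro measurable_empirical_measure[OF that]) simp
  have Y_meas: "?Y n \<in> borel_measurable \<Omega>" for n
  proof (cases "n \<ge> 1")
    case True
    show ?thesis
      by (rule measurable_posterior_mass[OF model prior E_meas[OF True]
            mmd_superlevel_set(1)[OF model prior P0]])
  next
    \<comment> \<open>For \<open>n = 0\<close> the empirical measure does not depend on the sample.\<close>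
    case False
    then show ?thesis by (simp add: empirical_measure_def)
  qed
  have "embedding (P \<theta>s) = embedding P0"
    using measurable_space[OF model] by (intro argmin_mmd_well_specified[OF _ well_specified \<theta>s_argmin]) auto
  then have mmd_\<theta>s: "mmd H ip R (P \<theta>s) = mmd H ip R P0" for R by (simp add: mmd_def)
  have r2: "(?r n)\<^sup>2 = 1 / real n" if "n \<ge> 1" for n
    using that by (simp add: power2_eq_square powr_add[symmetric] powr_minus_divide)
  have small: "?Y n \<omega> \<le> 4 / (M n)\<^sup>2"
    if n: "n \<ge> 1" and M4: "M n \<ge> 4" and \<omega>: "\<omega> \<in> space \<Omega>"
      and close: "mmd H ip P0 (?E n \<omega>) \<le> M n * ?r n / 4" for n \<omega>
  proof (rule posterior_mass_bound[OF model prior P0 measurable_space[OF E_meas[OF n] \<omega>] _ _ M4 _ close])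
    show "\<beta> n > 0" using \<beta>_pos n by simp
    show "?r n > 0" using n by simp
    show "exp (- \<beta> n * (?r n)\<^sup>2) \<le> measure \<pi> {\<theta> \<in> space T. mmd H ip (P \<theta>) P0 \<le> ?r n}"
      using prior_mass n unfolding r2[OF n] mmd_\<theta>s by simp
  qed
  have "(\<lambda>n. measure \<Omega> {\<omega> \<in> space \<Omega>. \<bar>?Y n \<omega> - 0\<bar> > \<epsilon>}) \<longlonglongrightarrow> 0" if \<epsilon>: "\<epsilon> > 0" for \<epsilon>
  proof (rule tendsto_sandwich[OF _ _ tendsto_const])
    have inv_M: "((\<lambda>n. c / (M n)\<^sup>2) \<longlonglongrightarrow> 0)" for c
      by (intro real_tendsto_divide_at_top[OF tendsto_const] filterlim_pow_at_top M_infinity) simp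
    from inv_M show "(\<lambda>n. 16 / (M n)\<^sup>2) \<longlonglongrightarrow> 0" .
    have "\<forall>\<^sub>F n in sequentially. n \<ge> 1 \<and> M n \<ge> 4 \<and> 4 / (M n)\<^sup>2 < \<epsilon>"
      using eventually_ge_at_top[of 1] M_infinity order_tendstoD(2)[OF inv_M \<epsilon>, of 4]
      by (intro eventually_conj) (auto simp: filterlim_at_top)
    then show "\<forall>\<^sub>F n in sequentially. measure \<Omega> {\<omega> \<in> space \<Omega>. \<bar>?Y n \<omega> - 0\<bar> > \<epsilon>} \<le> 16 / (M n)\<^sup>2"
    proof eventually_elim
      case (elim n)
      then have n: "n \<ge> 1" and M4: "M n \<ge> 4" and Me: "4 / (M n)\<^sup>2 < \<epsilon>" by auto
      have pos: "M n * ?r n / 4 > 0" using n M4 by simp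
      have "measure \<Omega> {\<omega> \<in> space \<Omega>. \<bar>?Y n \<omega> - 0\<bar> > \<epsilon>}
          \<le> measure \<Omega> {\<omega> \<in> space \<Omega>. mmd H ip P0 (?E n \<omega>) > M n * ?r n / 4}"
      proof (rule finite_measure_mono)
        have "(\<lambda>\<omega>. mmd H ip P0 (?E n \<omega>)) \<in> borel_measurable \<Omega>"
          by (intro measurable_mmd measurable_const P0 E_meas n)
        then show "{\<omega> \<in> space \<Omega>. mmd H ip P0 (?E n \<omega>) > M n * ?r n / 4} \<in> events" by simp
        show "{\<omega> \<in> space \<Omega>. \<bar>?Y n \<omega> - 0\<bar> > \<epsilon>}
            \<subseteq> {\<omega> \<in> space \<Omega>. mmd H ip P0 (?E n \<omega>) > M n * ?r n / 4}"
          using small[OF n M4] Me by (fastforce simp: not_less[symmetric])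
      qed
      also have "\<dots> \<le> 1 / (real n * (M n * ?r n / 4)\<^sup>2)"
        using X_distr by (intro prob_mmd_empirical_gt[OF sample_space X_indep _ P0 n pos]) simp
      also have "\<dots> = 16 / (M n)\<^sup>2"
        unfolding power_mult_distrib power_divide r2[OF n] using n by simp
      finally show ?case .
    qed
  qed simp
  with Y_meas show ?thesis unfolding converges_in_probability_def by blast
qed

end
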